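(* Let $(X,d)$ be a metric space, let $E\subset X$ be a bounded $s$-regular set with regularity constant $C_E$, let $0<t<s$, and let $n$ be a positive integer with $t<n$. Then there are a $t$-regular subset $F$ of $E$ and a bilipschitz map $f:F\to C(t,d(E))$, where $C(t,d(E))\subset\mathbb{R}^n$ is the standard $t$-dimensional Cantor set built from a closed cube of side-length $d(E)$. Moreover, $F$ can be taken so that $C_F\le C$, where $C$ depends only on $s,t,n$ and $C_E$.
   Context: $B(x,r)$ denotes the closed ball with center $x$ and radius $r$; $d(E)$ denotes the diameter of $E$. Regular sets: for $0<s<\infty$, a set $E\subset X$ is $s$-regular if it is closed and there exist a Borel (outer) measure $\mu$ on $X$ and a constant $C_E$, $1\le C_E<\infty$, such that $\mu(X\setminus E)=0$ and $$r^s\le \mu(B(x,r))\le C_E r^s\quad\text{for all } x\in E,\ 0<r\le d(E),\ r<\infty.$$ $C_E$ always denotes a constant for which this holds; "$C_F\le C$" for a $t$-regular set $F$ means that the condition for $F$ (with exponent $t$) holds with some measure and some constant $C_F\le C$. Conventions: regular sets contain at least two points, and closed and bounded subsets of regular sets are compact (equivalently, regular sets are complete). Bilipschitz maps: a map $f:F\to G$ between metric spaces is bilipschitz if it is onto and there is $L>0$ with $d(x,y)/L\le d(f(x),f(y))\le L\,d(x,y)$ for all $x,y\in F$. Cantor sets: for $0<t<n$ and $a>0$, define $0<\delta<1/2$ by $2^n\delta^t=1$. Let $Q\subset\mathbb{R}^n$ be a closed cube of side-length $a$, and let $Q_1,\dots,Q_{2^n}\subset Q$ be the closed cubes of side-length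 $\delta a$ in the corners of $Q$. Continue this process: given the closed cube $Q_{i_1\dots i_k}$ of side-length $\delta^k a$, let $Q_{i_1\dots i_k i}$, $i=1,\dots,2^n$, be the closed cubes of side-length $\delta^{k+1}a$ in its corners. Then $$C(t,a)=\bigcap_{k=1}^{\infty}\ \bigcup_{i_1\dots i_k}Q_{i_1\dots i_k},\qquad i_j\in\{1,\dots,2^n\}.$$ *)

theory Defs
  imports "HOL-Analysis.Analysis"
begin

text \<open>The set \<open>E\<close> is \<open>s\<close>-regular and its regularity condition holds with the constant \<open>C\<close>. The
  conventions that a regular set has at least two points and that its closed and bounded subsets
  are compact are part of the definition. For an unbounded \<open>E\<close> the diameter is infinite, and
  \<^term>\<open>diameter E\<close> is then not meaningful, whence the guard.\<close>

definition regular_set_const ::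
    "real \<Rightarrow> real \<Rightarrow> 'a::metric_space set \<Rightarrow> bool" where
  "regular_set_const s C E \<longleftrightarrow>
     0 < s \<and> 1 \<le> C \<and> closed E \<and>
     (\<exists>x\<in>E. \<exists>y\<in>E. x \<noteq> y) \<and>
     (\<forall>K. K \<subseteq> E \<longrightarrow> closed K \<longrightarrow> bounded K \<longrightarrow> compact K) \<and>
     (\<exists>\<mu> :: 'a measure. sets \<mu> = sets borel \<and> emeasure \<mu> (UNIV - E) = 0 \<and>
        (\<forall>x\<in>E. \<forall>r>0. (bounded E \<longrightarrow> r \<le> diameter E) \<longrightarrow>
           ennreal (r powr s) \<le> emeasure \<mu> (cball x r) \<and>
           emeasure \<mu> (cball x r) \<le> ennreal (C * r powr s)))"

definition bilipschitz_map ::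
    "('a \<Rightarrow> 'a \<Rightarrow> real) \<Rightarrow> 'a set \<Rightarrow> ('b \<Rightarrow> 'b \<Rightarrow> real) \<Rightarrow> 'b set \<Rightarrow> ('a \<Rightarrow> 'b) \<Rightarrow> bool" where
  "bilipschitz_map d F d' G f \<longleftrightarrow>
     f ` F = G \<and>
     (\<exists>L>0. \<forall>x\<in>F. \<forall>y\<in>F. d x y / L \<le> d' (f x) (f y) \<and> d' (f x) (f y) \<le> L * d x y)"

text \<open>Since \<open>n\<close> is a natural number on which a constant is going to depend, the space
  \<open>\<real>\<close>\<open>\<^sup>n\<close> is realised as in \<^const>\<open>Euclidean_space\<close>: its points are the functions
  \<open>x :: nat \<Rightarrow> real\<close> with \<open>x i = 0\<close> for \<open>i \<ge> n\<close>.\<close>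

definition euclid_dist :: "nat \<Rightarrow> (nat \<Rightarrow> real) \<Rightarrow> (nat \<Rightarrow> real) \<Rightarrow> real" where
  "euclid_dist n x y = L2_set (\<lambda>i. x i - y i) {..<n}"

definition closed_cube :: "nat \<Rightarrow> (nat \<Rightarrow> real) \<Rightarrow> real \<Rightarrow> (nat \<Rightarrow> real) set" where
  "closed_cube n q l = {x. (\<forall>i<n. q i \<le> x i \<and> x i \<le> q i + l) \<and> (\<forall>i\<ge>n. x i = 0)}"

definition cantor_ratio :: "nat \<Rightarrow> real \<Rightarrow> real" where
  "cantor_ratio n t = 2 powr (- (real n / t))"

lemma cantor_ratio_iff:
  assumes "0 < t" "t < real n"
  shows "0 < \<delta> \<and> \<delta> < 1/2 \<and> 2 ^ n * \<delta> powr t = 1 \<longleftrightarrow> \<delta> = cantor_ratio n t"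
proof
  assume L: "0 < \<delta> \<and> \<delta> < 1/2 \<and> 2 ^ n * \<delta> powr t = 1"
  then have "ln (2 ^ n * \<delta> powr t) = 0" by simp
  moreover have "ln (2 ^ n * \<delta> powr t) = ln (2 ^ n) + ln (\<delta> powr t)"
    using L by (intro ln_mult_pos) auto
  ultimately have "real n * ln 2 + t * ln \<delta> = 0"
    using L by (simp only: ln_realpow ln_powr)
  then have "ln \<delta> = - (real n / t) * ln 2"
    using assms by (simp add: field_simps)
  then show "\<delta> = cantor_ratio n t"
    using L unfolding cantor_ratio_def powr_def by (metis exp_ln zero_neq_numeral)
next
  assume R: "\<delta> = cantor_ratio n t"
  have "(2::real) powr (- (real n / t)) < 2 powr (- 1)"
    using assms by (intro powr_less_mono) (auto simp: field_simps)
  then have "\<delta> < 1/2" using R by (simp add: cantor_ratio_def powr_minus_divide)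
  moreover have "\<delta> powr t = 2 powr (- real n)"
    using assms R by (simp add: cantor_ratio_def powr_powr)
  then have "2 ^ n * \<delta> powr t = 1"
    by (simp add: powr_minus powr_realpow)
  ultimately show "0 < \<delta> \<and> \<delta> < 1/2 \<and> 2 ^ n * \<delta> powr t = 1"
    using R by (simp add: cantor_ratio_def)
qed

text \<open>The lowest vertices of the \<open>k\<close>-th generation cubes, which have side-length \<open>\<delta>\<^sup>k a\<close>; the
  initial cube has lowest vertex \<open>p\<close>. The \<open>2\<^sup>n\<close> corners of a cube are indexed by the subsets
  \<open>S\<close> of the coordinates: those in which the subcube touches the upper face.\<close>

primrec cantor_vertices ::
    "nat \<Rightarrow> real \<Rightarrow> real \<Rightarrow> (nat \<Rightarrow> real) \<Rightarrow> nat \<Rightarrow> (nat \<Rightarrow> real) set" where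
  "cantor_vertices n \<delta> a p 0 = {p}"
| "cantor_vertices n \<delta> a p (Suc k) =
     {(\<lambda>i. if i \<in> S then q i + \<delta> ^ k * a - \<delta> ^ Suc k * a else q i) | q S.
        q \<in> cantor_vertices n \<delta> a p k \<and> S \<subseteq> {..<n}}"

text \<open>The Cantor set \<open>C(t,a)\<close> in \<open>\<real>\<close>\<open>\<^sup>n\<close> built from the cube of side-length \<open>a\<close> with lowest
  vertex \<open>p\<close>.\<close>

definition cantor_set :: "nat \<Rightarrow> real \<Rightarrow> real \<Rightarrow> (nat \<Rightarrow> real) \<Rightarrow> (nat \<Rightarrow> real) set" where
  "cantor_set n t a p =
     (\<Inter>k\<in>{1..}. \<Union>q\<in>cantor_vertices n (cantor_ratio n t) a p k.
        closed_cube n q (cantor_ratio n t ^ k * a))"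

text \<open>A constant determined by \<open>s\<close>, \<open>t\<close>, \<open>n\<close> and \<open>K\<close> alone. An existential quantifier over
  the constant in a theorem about sets in a metric space \<open>'a\<close> would let it depend on \<open>'a\<close>, as HOL
  does not quantify over types inside a formula. A choice is therefore made once and for all in one
  space, the bounded sequences with the supremum metric, into which every separable metric space,
  in particular every bounded regular set, embeds isometrically. A theorem stating that the
  chosen value serves in an arbitrary \<open>'a\<close> then has the required uniformity, however the value was
  chosen; its instance for the space of bounded sequences says that an admissible choice
  exists.\<close>

definition regular_subset_const :: "real \<Rightarrow> real \<Rightarrow> nat \<Rightarrow> real \<Rightarrow> real" where
  "regular_subset_const s t n K =
     (SOME C. \<forall>(E :: (nat \<Rightarrow>\<^sub>C real) set) p.
        regular_set_const s K E \<longrightarrow> bounded E \<longrightarrow>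
        (\<exists>F f C_F. F \<subseteq> E \<and> regular_set_const t C_F F \<and>
           bilipschitz_map dist F (euclid_dist n) (cantor_set n t (diameter E) p) f \<and>
           C_F \<le> C))"

end

theory Submission
  imports Defs "HOL-Probability.Infinite_Product_Measure"
begin

text \<open>With \<open>\<delta> = cantor_ratio n t\<close>, a volume count shows that a ball of radius \<open>r\<close> centred at \<open>E\<close> contains
  at least \<open>c \<lambda>\<^sup>-\<^sup>s\<close> points of \<open>E\<close> that are \<open>4 \<lambda> r\<close>-separated. As \<open>t < s\<close>, the constant \<open>c\<close> is absorbed
  by taking \<open>\<lambda> = \<delta>\<^sup>m\<close> with \<open>m\<close> large, depending on \<open>s\<close>, \<open>t\<close>, \<open>n\<close> and \<open>C_E\<close> only, and there are then
  enough points for the \<open>2\<^sup>n\<^sup>m = \<lambda>\<^sup>-\<^sup>t\<close> cubes that \<open>m\<close> consecutive steps of the Cantor construction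
  produce. Iterating gives a tree of points in \<open>E\<close> with the same combinatorics and, up to constants, the
  same scales as the tree of Cantor cubes. The points of \<open>F\<close> and of \<open>C(t,d(E))\<close> are thus coded by the same
  infinite words; identifying equal codes is bilipschitz, and the image of the uniform product
  measure on words makes \<open>F\<close> a \<open>t\<close>-regular set with constant \<open>4\<^sup>n\<^sup>m\<close>. Since the constant of the statement
  is chosen among bounded sequences, \<open>E\<close> is first embedded isometrically into that space.\<close>

subsection \<open>Codings of subsets of a regular set\<close>

lemma diameter_pos:
  assumes "bounded E" "x \<in> E" "y \<in> E" "x \<noteq> y"
  shows "0 < diameter E"
  using diameter_bounded_bound[OF assms(1-3)] assms(4) by (metis dist_pos_lt less_le_trans)

lemma regular_set_const_diameter_pos:
  "regular_set_const s K E \<Longrightarrow> bounded E \<Longrightarrow> 0 < diameter E"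
  unfolding regular_set_const_def using diameter_pos by metis

lemma regular_set_const_compact:
  "regular_set_const s K E \<Longrightarrow> bounded E \<Longrightarrow> compact E"
  unfolding regular_set_const_def by blast

text \<open>Points are added greedily. If the balls of radius \<open>4 * l * r\<close> around
  \<open>j < N\<close> chosen points covered the part of \<open>E\<close> in
  \<open>cball x (r / 2)\<close>, the two regularity bounds would give
  \<open>1 \<le> j * (K * (8 * l) powr s)\<close>, against the hypothesis on
  \<open>N\<close>.\<close>

lemma separated_points_exist:
  fixes E :: "'a::metric_space set"
  assumes reg: "regular_set_const s K E" and bdd: "bounded E"
    and x: "x \<in> E" and r: "0 < r" "r \<le> diameter E"
    and l: "0 < l" "4 * l \<le> 1" and N: "real N * (K * (8 * l) powr s) \<le> 1"
    and j: "j \<le> N"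
  shows "\<exists>Y. finite Y \<and> card Y = j \<and> Y \<subseteq> E \<inter> cball x (r / 2) \<and>
           (\<forall>y\<in>Y. \<forall>y'\<in>Y. y \<noteq> y' \<longrightarrow> 4 * l * r < dist y y')"
  using j
proof (induction j)
  case 0
  show ?case by (intro exI[of _ "{}"]) auto
next
  case (Suc j)
  then obtain Y where Y: "finite Y" "card Y = j" "Y \<subseteq> E \<inter> cball x (r / 2)"
    "\<And>y y'. y \<in> Y \<Longrightarrow> y' \<in> Y \<Longrightarrow> y \<noteq> y' \<Longrightarrow> 4 * l * r < dist y y'"
    by (metis Suc_leD)
  from reg obtain \<mu> :: "'a measure" where
    K: "1 \<le> K" and E: "closed E" and sets: "sets \<mu> = sets borel" and null: "emeasure \<mu> (UNIV - E) = 0"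
    and ball: "\<And>x r. x \<in> E \<Longrightarrow> 0 < r \<Longrightarrow> r \<le> diameter E \<Longrightarrow>
      ennreal (r powr s) \<le> emeasure \<mu> (cball x r) \<and> emeasure \<mu> (cball x r) \<le> ennreal (K * r powr s)"
    unfolding regular_set_const_def by blast
  have meas: "UNIV - E \<in> sets \<mu>" "(\<Union>y\<in>Y. cball y (4 * l * r)) \<in> sets \<mu>"
    using E Y(1) by (auto simp: sets intro!: sets.finite_UN)
  \<comment> \<open>\<open>4 * l \<le> 1\<close> keeps the covering radius in the range where
    regularity bounds balls from above.\<close>
  have lr: "4 * l * r \<le> diameter E" "0 < 4 * l * r"
    using l r order_trans[OF mult_right_mono[of "4 * l" 1 r]] by simp_all
  have "\<exists>z\<in>E \<inter> cball x (r / 2). \<forall>y\<in>Y. 4 * l * r < dist y z"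
  proof (rule ccontr)
    assume "\<not> ?thesis"
    then have cover: "cball x (r / 2) \<subseteq> (UNIV - E) \<union> (\<Union>y\<in>Y. cball y (4 * l * r))"
      by (force simp: not_less)
    have "ennreal ((r / 2) powr s) \<le> emeasure \<mu> (cball x (r / 2))"
      using ball[OF x, of "r / 2"] r by simp
    also have "\<dots> \<le> emeasure \<mu> ((UNIV - E) \<union> (\<Union>y\<in>Y. cball y (4 * l * r)))"
      by (intro emeasure_mono cover sets.Un meas)
    also have "\<dots> \<le> emeasure \<mu> (UNIV - E) + emeasure \<mu> (\<Union>y\<in>Y. cball y (4 * l * r))"
      by (intro emeasure_subadditive meas)
    also have "\<dots> \<le> (\<Sum>y\<in>Y. emeasure \<mu> (cball y (4 * l * r)))"
      using emeasure_subadditive_finite[OF Y(1), of "\<lambda>y. cball y (4 * l * r)" \<mu>]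
      by (simp add: null sets image_subset_iff)
    also have "\<dots> \<le> (\<Sum>y\<in>Y. ennreal (K * (4 * l * r) powr s))"
      using Y(3) lr ball by (intro sum_mono) blast
    also have "\<dots> = ennreal (j * (K * (4 * l * r) powr s))"
      using Y(2) K by (simp add: ennreal_mult ennreal_of_nat_eq_real_of_nat)
    finally have "(r / 2) powr s \<le> j * (K * (4 * l * r) powr s)"
      using K by (simp add: ennreal_le_iff)
    also have "4 * l * r = 8 * l * (r / 2)" by simp
    also have "(8 * l * (r / 2)) powr s = (8 * l) powr s * (r / 2) powr s"
      by (rule powr_mult)
    finally have "1 * (r / 2) powr s \<le> (j * (K * (8 * l) powr s)) * (r / 2) powr s"
      by (simp add: mult_ac)
    then have "1 \<le> j * (K * (8 * l) powr s)"
      using r by (subst (asm) mult_le_cancel_right) auto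
    also have "\<dots> < real N * (K * (8 * l) powr s)"
      using Suc.prems K l by (intro mult_strict_right_mono) auto
    finally show False using N by simp
  qed
  then obtain z where z: "z \<in> E \<inter> cball x (r / 2)" "\<And>y. y \<in> Y \<Longrightarrow> 4 * l * r < dist y z"
    by blast
  have "z \<notin> Y" using z(2)[of z] lr by auto
  then show ?case
    using Y z by (intro exI[of _ "insert z Y"]) (auto simp: dist_commute)
qed

definition codes :: "nat \<Rightarrow> (nat \<Rightarrow> nat set) set" where
  "codes n = {w. \<forall>k. w k \<subseteq> {..<n}}"

text \<open>A point \<^term>\<open>z w\<close> for each infinite word \<open>w\<close>, whose letters are the sets of coordinates that index the
  corners of a cube. The distance of two such points is comparable to \<open>\<delta>\<^sup>j D\<close>, \<open>j\<close> being the first place where the words differ;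
  the scales are only controlled in blocks of \<open>m\<close> letters.\<close>

locale coding =
  fixes z :: "(nat \<Rightarrow> nat set) \<Rightarrow> 'a::metric_space" and n m :: nat and \<delta> D :: real
  assumes m: "0 < m" and \<delta>: "0 < \<delta>" "\<delta> < 1" and D: "0 < D"
    and dist_le: "\<And>w w' k. w \<in> codes n \<Longrightarrow> w' \<in> codes n \<Longrightarrow> (\<And>j. j < m * k \<Longrightarrow> w j = w' j) \<Longrightarrow>
      dist (z w) (z w') \<le> 2 * \<delta> ^ (m * k) * D"
    and dist_ge: "\<And>w w' j k. w \<in> codes n \<Longrightarrow> w' \<in> codes n \<Longrightarrow> w j \<noteq> w' j \<Longrightarrow> j < m * Suc k \<Longrightarrow>
      2 * \<delta> ^ (m * Suc k) * D \<le> dist (z w) (z w')"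

text \<open>Every point gets \<open>(2 ^ n) ^ m\<close> separated children, one for each block of
  \<open>m\<close> letters, at the scale ratio \<open>\<delta> ^ m\<close>. Following the blocks of
  a word \<open>w\<close> gives points of \<open>E\<close> that converge to
  \<open>z w\<close>.\<close>

lemma coding_exists:
  fixes E :: "'a::metric_space set"
  assumes reg: "regular_set_const s K E" and bdd: "bounded E"
    and m: "0 < m" and \<delta>: "0 < \<delta>" "\<delta> < 1" "4 * \<delta> ^ m \<le> 1"
    and N: "(2 ^ n) ^ m * (K * (8 * \<delta> ^ m) powr s) \<le> 1"
  shows "\<exists>z. z ` codes n \<subseteq> E \<and> coding z n m \<delta> (diameter E)"
proof -
  define D where "D = diameter E"
  define B where "B = PiE {..<m} (\<lambda>_. Pow {..<n})"
  define l where "l = \<delta> ^ m"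
  have D: "0 < D" using regular_set_const_diameter_pos[OF reg bdd] by (simp add: D_def)
  have l: "0 < l" "l < 1" "4 * l \<le> 1" using \<delta> m by (auto simp: l_def power_less_one_iff)
  have B: "finite B" "card B = (2 ^ n) ^ m"
    by (auto simp: B_def card_PiE card_Pow intro!: finite_PiE)
  have "\<exists>g. \<forall>b\<in>B. g b \<in> E \<inter> cball x (r / 2) \<and>
          (\<forall>b'\<in>B. b \<noteq> b' \<longrightarrow> 4 * l * r < dist (g b) (g b'))"
    if "x \<in> E" "0 < r" "r \<le> D" for x r
  proof -
    have "\<exists>Y. finite Y \<and> card Y = card B \<and> Y \<subseteq> E \<inter> cball x (r / 2) \<and>
           (\<forall>y\<in>Y. \<forall>y'\<in>Y. y \<noteq> y' \<longrightarrow> 4 * l * r < dist y y')"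
      using that N l by (intro separated_points_exist[OF reg bdd]) (auto simp: D_def l_def B)
    then obtain Y where Y: "finite Y" "card Y = card B" "Y \<subseteq> E \<inter> cball x (r / 2)"
      "\<forall>y\<in>Y. \<forall>y'\<in>Y. y \<noteq> y' \<longrightarrow> 4 * l * r < dist y y'"
      by (elim exE conjE)
    obtain g where g: "bij_betw g B Y"
      using finite_same_card_bij[OF B(1) Y(1)] Y(2) by auto
    have "g b \<in> Y" if "b \<in> B" for b using g that by (auto simp: bij_betw_def)
    moreover have "g b \<noteq> g b'" if "b \<in> B" "b' \<in> B" "b \<noteq> b'" for b b'
      using g that by (auto simp: bij_betw_def inj_on_def)
    ultimately show ?thesis using Y(3,4) by (intro exI[of _ g]) (meson subsetD)
  qed
  then obtain g where g: "\<And>x r b. x \<in> E \<Longrightarrow> 0 < r \<Longrightarrow> r \<le> D \<Longrightarrow> b \<in> B \<Longrightarrow> g x r b \<in> E \<inter> cball x (r / 2)"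
    and g_sep: "\<And>x r b b'. x \<in> E \<Longrightarrow> 0 < r \<Longrightarrow> r \<le> D \<Longrightarrow> b \<in> B \<Longrightarrow> b' \<in> B \<Longrightarrow> b \<noteq> b' \<Longrightarrow>
      4 * l * r < dist (g x r b) (g x r b')"
    by metis
  obtain x0 where x0: "x0 \<in> E" using reg unfolding regular_set_const_def by blast
  define blk where "blk k w = restrict (\<lambda>j. w (m * k + j)) {..<m}" for k and w :: "nat \<Rightarrow> nat set"
  define X where "X k w = rec_nat x0 (\<lambda>k x. g x (l ^ k * D) (blk k w)) k" for k w
  have X0: "X 0 w = x0" and XSuc: "X (Suc k) w = g (X k w) (l ^ k * D) (blk k w)" for k w
    by (simp_all add: X_def)
  have blk: "blk k w \<in> B" if "w \<in> codes n" for k w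
    using that by (auto simp: blk_def B_def codes_def)
  have rad: "0 < l ^ k * D" "l ^ k * D \<le> D" for k
    using l D by (auto simp: power_le_one)
  have XE: "X k w \<in> E" if "w \<in> codes n" for k w
    by (induction k) (use x0 g rad blk that in \<open>auto simp: X0 XSuc\<close>)
  have step: "dist (X k w) (X (Suc k) w) \<le> l ^ k * D / 2" if "w \<in> codes n" for k w
    using g[OF XE[OF that] rad[of k] blk[OF that]] by (auto simp: XSuc)
  \<comment> \<open>The first step uses half of the scale; as \<open>l \<le> 1 / 2\<close>, the
    later steps fit into the other half. This is why children are sought in balls of radius
    \<open>r / 2\<close>.\<close>
  have near: "dist (X k w) (X (k + i) w) \<le> l ^ k * D" if "w \<in> codes n" for k w i
  proof (induction i arbitrary: k)
    case 0
    then show ?case using rad[of k] by simp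
  next
    case (Suc i)
    have "dist (X k w) (X (k + Suc i) w)
        \<le> dist (X k w) (X (Suc k) w) + dist (X (Suc k) w) (X (Suc k + i) w)"
      using dist_triangle[of "X k w" "X (k + Suc i) w" "X (Suc k) w"] by simp
    also have "\<dots> \<le> l ^ k * D / 2 + l ^ Suc k * D" using step[OF that] Suc by (intro add_mono)
    also have "\<dots> \<le> l ^ k * D / 2 + 1 / 2 * (l ^ k * D)"
      using l rad[of k] unfolding power_Suc mult.assoc by (intro add_left_mono mult_right_mono) auto
    also have "\<dots> = l ^ k * D" by simp
    finally show ?case .
  qed
  have "\<exists>x\<in>E. \<forall>k. dist (X k w) x \<le> l ^ k * D" if w: "w \<in> codes n" for w
  proof -
    \<comment> \<open>A subsequential limit suffices, since the bound \<open>near\<close> holds for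
      all later points and is preserved by limits.\<close>
    have "seq_compact E"
      using regular_set_const_compact[OF reg bdd] by (rule compact_imp_seq_compact)
    then obtain x \<rho> where x: "x \<in> E" "strict_mono \<rho>" "((\<lambda>k. X k w) \<circ> \<rho>) \<longlonglongrightarrow> x"
      using XE[OF w] unfolding seq_compact_def by metis
    have "dist (X k w) x \<le> l ^ k * D" for k
    proof -
      have "(\<lambda>i. dist (X k w) (X (\<rho> i) w)) \<longlonglongrightarrow> dist (X k w) x"
        using x(3) by (intro tendsto_intros) (simp add: o_def)
      moreover have "eventually (\<lambda>i. dist (X k w) (X (\<rho> i) w) \<le> l ^ k * D) sequentially"
      proof (rule eventually_sequentiallyI[of k])
        fix i assume "k \<le> i"
        then have "k \<le> \<rho> i" using seq_suble[OF x(2)] by (meson order_trans)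
        then show "dist (X k w) (X (\<rho> i) w) \<le> l ^ k * D"
          using near[OF w, of k "\<rho> i - k"] by simp
      qed
      ultimately show ?thesis by (rule tendsto_upperbound) simp
    qed
    then show ?thesis using x(1) by blast
  qed
  then obtain z where zE: "\<And>w. w \<in> codes n \<Longrightarrow> z w \<in> E"
    and z: "\<And>w k. w \<in> codes n \<Longrightarrow> dist (X k w) (z w) \<le> l ^ k * D"
    by metis
  have X_cong: "X k w = X k w'" if "\<And>j. j < m * k \<Longrightarrow> w j = w' j" for k w w'
    using that
  proof (induction k)
    case (Suc k)
    have "blk k w = blk k w'" unfolding blk_def using Suc.prems by (intro restrict_ext) auto
    then show ?case using Suc by (simp add: XSuc)
  qed (simp add: X0)
  have "coding z n m \<delta> D"
  proof
    show "0 < m" "0 < \<delta>" "\<delta> < 1" "0 < D" by fact+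
  next
    fix w w' k assume w: "w \<in> codes n" "w' \<in> codes n" and eq: "\<And>j. j < m * k \<Longrightarrow> w j = w' j"
    have "X k w = X k w'" using eq by (rule X_cong)
    then show "dist (z w) (z w') \<le> 2 * \<delta> ^ (m * k) * D"
      using z[OF w(1), of k] z[OF w(2), of k] dist_triangle3[of "z w" "z w'" "X k w"]
      by (simp add: l_def power_mult)
  next
    fix w w' j k assume w: "w \<in> codes n" "w' \<in> codes n" and j: "w j \<noteq> w' j" "j < m * Suc k"
    \<comment> \<open>The first disagreement \<open>i\<close> lies in block \<open>q\<close>: the
      words share the ancestor at level \<open>q\<close> and continue to different children of
      it.\<close>
    define i where "i = (LEAST i. w i \<noteq> w' i)"
    have i: "w i \<noteq> w' i" "i \<le> j" "\<And>i'. i' < i \<Longrightarrow> w i' = w' i'"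
      unfolding i_def using LeastI[of "\<lambda>i. w i \<noteq> w' i", OF j(1)] j(1) not_less_Least
      by (auto intro: Least_le)
    define q where "q = i div m"
    have "m * q \<le> i" by (simp add: q_def)
    have Xq: "X q w = X q w'" by (intro X_cong i) (use \<open>m * q \<le> i\<close> in linarith)
    have "i mod m < m" "i = m * q + i mod m" using m by (auto simp: q_def)
    then have "blk q w \<noteq> blk q w'"
      using i(1) unfolding blk_def by (metis lessThan_iff restrict_apply)
    then have "4 * l * (l ^ q * D) < dist (X (Suc q) w) (X (Suc q) w')"
      unfolding XSuc Xq by (intro g_sep XE rad blk w)
    moreover have "dist (X (Suc q) w) (X (Suc q) w') \<le>
        dist (X (Suc q) w) (z w) + dist (z w) (z w') + dist (X (Suc q) w') (z w')"
      using dist_triangle[of "X (Suc q) w" "X (Suc q) w'" "z w"]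
        dist_triangle2[of "z w" "X (Suc q) w'" "z w'"] by linarith
    \<comment> \<open>Passing to the limits costs \<open>l ^ Suc q * D\<close> at each end, so half
      of the separation \<open>4 * l ^ Suc q * D\<close> remains.\<close>
    ultimately have *: "2 * (l ^ Suc q * D) \<le> dist (z w) (z w')"
      using z[OF w(1), of "Suc q"] z[OF w(2), of "Suc q"] by (simp add: mult_ac)
    have "q \<le> k"
      using i(2) j(2) less_mult_imp_div_less[of i "Suc k" m] by (simp add: q_def mult.commute)
    then have "l ^ Suc k \<le> l ^ Suc q" using l by (intro power_decreasing) auto
    then have "2 * (l ^ Suc k * D) \<le> 2 * (l ^ Suc q * D)"
      using D by (intro mult_left_mono mult_right_mono) auto
    with * show "2 * \<delta> ^ (m * Suc k) * D \<le> dist (z w) (z w')"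
      unfolding l_def power_mult[symmetric] by simp
  qed
  then show ?thesis using zE by (auto simp: D_def)
qed

subsection \<open>Regularity of a coded set\<close>

context coding
begin

lemma z_eqD:
  assumes "w \<in> codes n" "w' \<in> codes n" "z w = z w'"
  shows "w = w'"
proof
  fix j
  show "w j = w' j"
  proof (rule ccontr)
    assume "w j \<noteq> w' j"
    moreover have "j < m * Suc j" using m by (cases m) auto
    ultimately have "2 * \<delta> ^ (m * Suc j) * D \<le> 0"
      using dist_ge[OF assms(1,2), of j j] assms(3) by simp
    moreover have "0 < 2 * \<delta> ^ (m * Suc j) * D" using \<delta>(1) D by (intro mult_pos_pos zero_less_power) auto
    ultimately show False by linarith
  qed
qed

lemma inj_on_z: "inj_on z (codes n)"
  by (intro inj_onI z_eqD)

lemma scale_tendsto_0: "(\<lambda>k. 2 * \<delta> ^ (m * k) * D) \<longlonglongrightarrow> 0"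
proof -
  have "(\<lambda>k. 2 * (\<delta> ^ m) ^ k * D) \<longlonglongrightarrow> 2 * 0 * D"
    using \<delta> m by (intro tendsto_intros LIMSEQ_realpow_zero) (auto simp: power_less_one_iff)
  then show ?thesis by (simp add: power_mult)
qed

lemma scale_exists:
  assumes "0 < r" "r \<le> D"
  obtains k where "2 * \<delta> ^ (m * Suc k) * D \<le> r" "r < 2 * \<delta> ^ (m * k) * D"
proof -
  define P where "P k \<longleftrightarrow> 2 * \<delta> ^ (m * k) * D \<le> r" for k
  have "\<exists>k. P k"
    using order_tendstoD(2)[OF scale_tendsto_0 assms(1)]
    unfolding P_def eventually_sequentially by (meson less_imp_le order_refl)
  then have *: "P (LEAST k. P k)" by (rule LeastI_ex)
  \<comment> \<open>The scale of index 0 is \<open>2 * D > r\<close>, so the least index is a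
    successor.\<close>
  moreover have "\<not> P 0" using assms D by (simp add: P_def)
  ultimately obtain k where k: "(LEAST k. P k) = Suc k" by (metis not0_implies_Suc)
  with * not_less_Least[of k P] have "P (Suc k)" "\<not> P k" by auto
  then show thesis using that unfolding P_def by auto
qed

text \<open>Codes of points that approach \<open>y\<close> to within half of the separation at each
  scale agree on longer and longer initial parts. Their diagonal is a code of
  \<open>y\<close>.\<close>

lemma closed_image: "closed (z ` codes n)"
  unfolding closed_limpt
proof (intro allI impI)
  fix y assume y: "y islimpt z ` codes n"
  have "\<exists>w\<in>codes n. dist (z w) y < \<delta> ^ (m * Suc k) * D" for k
  proof -
    have "0 < \<delta> ^ (m * Suc k) * D" using \<delta> D by (intro mult_pos_pos zero_less_power)
    then show ?thesis using y unfolding islimpt_approachable by blast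
  qed
  then obtain v where v: "\<And>k. v k \<in> codes n" "\<And>k. dist (z (v k)) y < \<delta> ^ (m * Suc k) * D"
    by metis
  have agree: "v k j = v k' j" if "j < m * Suc k" "k \<le> k'" for k k' j
  proof (rule ccontr)
    assume "v k j \<noteq> v k' j"
    then have "2 * \<delta> ^ (m * Suc k) * D \<le> dist (z (v k)) (z (v k'))"
      using that(1) by (intro dist_ge v)
    also have "\<dots> \<le> dist (z (v k)) y + dist (z (v k')) y" by (rule dist_triangle2)
    also have "\<dots> < \<delta> ^ (m * Suc k) * D + \<delta> ^ (m * Suc k') * D" by (intro add_strict_mono v)
    also have "\<delta> ^ (m * Suc k') * D \<le> \<delta> ^ (m * Suc k) * D"
      using that \<delta> D by (intro mult_right_mono power_decreasing) auto
    finally show False by simp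
  qed
  \<comment> \<open>Letter \<open>j\<close> no longer changes from \<open>v j\<close> on, because
    \<open>j < m * Suc j\<close>.\<close>
  define w where "w j = v j j" for j
  have w: "w \<in> codes n" using v(1) by (auto simp: codes_def w_def)
  have "dist (z w) (z (v k)) \<le> 2 * \<delta> ^ (m * k) * D" for k
  proof (rule dist_le[OF w v(1)])
    fix j assume "j < m * k"
    moreover have "j < m * Suc j" using m by (cases m) auto
    moreover have "j < m * Suc k" using \<open>j < m * k\<close> by simp
    ultimately show "w j = v k j"
      using agree[of j j k] agree[of j k j, symmetric] unfolding w_def by (meson nat_le_linear)
  qed
  then have "(\<lambda>k. dist (z w) (z (v k))) \<longlonglongrightarrow> 0"
    by (intro tendsto_sandwich[OF _ _ tendsto_const scale_tendsto_0]) auto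
  moreover have "(\<lambda>k. dist (z (v k)) y) \<longlonglongrightarrow> 0"
  proof (rule tendsto_sandwich[OF _ _ tendsto_const scale_tendsto_0])
    show "eventually (\<lambda>k. dist (z (v k)) y \<le> 2 * \<delta> ^ (m * k) * D) sequentially"
    proof (intro always_eventually allI)
      fix k
      have "\<delta> ^ (m * Suc k) * D \<le> \<delta> ^ (m * k) * D"
        using \<delta> D by (intro mult_right_mono power_decreasing) auto
      moreover have "0 \<le> \<delta> ^ (m * k) * D" using \<delta> D by simp
      ultimately show "dist (z (v k)) y \<le> 2 * \<delta> ^ (m * k) * D" using v(2)[of k] by simp
    qed
  qed simp
  ultimately have "(\<lambda>k. dist (z w) (z (v k)) + dist (z (v k)) y) \<longlonglongrightarrow> 0 + 0"
    by (rule tendsto_add)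
  then have "dist (z w) y \<le> 0 + 0"
    by (rule tendsto_lowerbound) (simp_all add: dist_triangle)
  then show "y \<in> z ` codes n" using w by auto
qed

end

section \<open>The uniform product measure on words\<close>

definition code_measure :: "nat \<Rightarrow> (nat \<Rightarrow> nat set) measure" where
  "code_measure n = PiM UNIV (\<lambda>_. uniform_count_measure (Pow {..<n}))"

lemma prob_space_code_measure_component: "prob_space (uniform_count_measure (Pow {..<n::nat}))"
  by (rule prob_space_uniform_count_measure) auto

lemma space_code_measure: "space (code_measure n) = codes n"
  by (auto simp: code_measure_def space_PiM space_uniform_count_measure codes_def PiE_iff)

lemma cylinder:
  assumes "w \<in> codes n"
  shows cylinder_in_sets: "{w'\<in>codes n. \<forall>j<K. w' j = w j} \<in> sets (code_measure n)"
    and emeasure_cylinder: "emeasure (code_measure n) {w'\<in>codes n. \<forall>j<K. w' j = w j} = ennreal ((1 / 2 ^ n) ^ K)"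
proof -
  interpret product_prob_space "\<lambda>_. uniform_count_measure (Pow {..<n})" "UNIV :: nat set"
    by (intro product_prob_spaceI prob_space_code_measure_component)
  have eq: "{w'\<in>codes n. \<forall>j<K. w' j = w j} =
    {w'\<in>space (Pi\<^sub>M UNIV (\<lambda>_. uniform_count_measure (Pow {..<n}))). \<forall>j\<in>{..<K}. w' j \<in> {w j}}"
    using space_code_measure[of n] by (auto simp: code_measure_def)
  have w: "{w j} \<in> sets (uniform_count_measure (Pow {..<n}))" for j
    using assms by (auto simp: sets_uniform_count_measure codes_def)
  have "emeasure (code_measure n) {w'\<in>codes n. \<forall>j<K. w' j = w j} =
      (\<Prod>j<K. emeasure (uniform_count_measure (Pow {..<n})) {w j})"
    unfolding eq code_measure_def by (intro emeasure_PiM_Collect w) auto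
  also have "\<dots> = (\<Prod>j<K. ennreal (1 / 2 ^ n))"
    using assms by (intro prod.cong refl)
      (subst emeasure_uniform_count_measure, auto simp: codes_def card_Pow)
  also have "\<dots> = ennreal ((1 / 2 ^ n) ^ K)" by (simp add: ennreal_power)
  finally show "emeasure (code_measure n) {w'\<in>codes n. \<forall>j<K. w' j = w j} = ennreal ((1 / 2 ^ n) ^ K)" .
  have "(\<lambda>w'. w' j) -` {w j} \<inter> space (code_measure n) \<in> sets (code_measure n)" for j
    unfolding code_measure_def using w by (intro measurable_sets[OF measurable_component_singleton]) auto
  then have "{w'\<in>space (code_measure n). w' j = w j} \<in> sets (code_measure n)" for j
    by (simp add: vimage_def Int_def conj_commute)
  then have "{w'\<in>space (code_measure n). \<forall>j\<in>{..<K}. w' j = w j} \<in> sets (code_measure n)"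
    by (rule sets.sets_Collect_finite_All) simp
  also have "{w'\<in>space (code_measure n). \<forall>j\<in>{..<K}. w' j = w j} = {w'\<in>codes n. \<forall>j<K. w' j = w j}"
    unfolding space_code_measure by blast
  finally show "{w'\<in>codes n. \<forall>j<K. w' j = w j} \<in> sets (code_measure n)" .
qed

text \<open>A preimage is a union of cylinders of length \<open>K\<close>, and there are only
  finitely many of these because each letter is one of \<open>2 ^ n\<close> sets.\<close>

lemma measurable_code_measure_finite_dependence:
  fixes h :: "(nat \<Rightarrow> nat set) \<Rightarrow> 'a::topological_space"
  assumes "\<And>w w'. w \<in> codes n \<Longrightarrow> w' \<in> codes n \<Longrightarrow> (\<And>j. j < K \<Longrightarrow> w j = w' j) \<Longrightarrow> h w = h w'"
  shows "h \<in> borel_measurable (code_measure n)"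
proof (rule measurableI)
  fix A :: "'a set" assume "A \<in> sets borel"
  define W where "W = {w\<in>codes n. h w \<in> A}"
  define cyl where "cyl w = {w'\<in>codes n. \<forall>j<K. w' j = w j}" for w
  have "cyl ` W \<subseteq> (\<lambda>b. {w'\<in>codes n. \<forall>j<K. w' j = b j}) ` PiE {..<K} (\<lambda>_. Pow {..<n})"
  proof
    fix C assume "C \<in> cyl ` W"
    then obtain w where "w \<in> W" "C = cyl w" by blast
    then show "C \<in> (\<lambda>b. {w'\<in>codes n. \<forall>j<K. w' j = b j}) ` PiE {..<K} (\<lambda>_. Pow {..<n})"
      by (intro image_eqI[of _ _ "restrict w {..<K}"]) (auto simp: cyl_def W_def codes_def)
  qed
  then have "finite (cyl ` W)" by (rule finite_subset) (auto intro!: finite_PiE)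
  then have "\<Union>(cyl ` W) \<in> sets (code_measure n)"
    by (rule sets.finite_Union) (auto simp: cyl_def W_def intro: cylinder_in_sets)
  also have "\<Union>(cyl ` W) = h -` A \<inter> space (code_measure n)"
  proof
    show "\<Union>(cyl ` W) \<subseteq> h -` A \<inter> space (code_measure n)"
    proof
      fix w' assume "w' \<in> \<Union>(cyl ` W)"
      then obtain w where w: "w \<in> codes n" "h w \<in> A" "w' \<in> codes n" "\<forall>j<K. w' j = w j"
        unfolding cyl_def W_def by blast
      then have "h w' = h w" by (intro assms) auto
      with w show "w' \<in> h -` A \<inter> space (code_measure n)" by (simp add: space_code_measure)
    qed
    show "h -` A \<inter> space (code_measure n) \<subseteq> \<Union>(cyl ` W)"
      by (auto simp: cyl_def W_def space_code_measure)
  qed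
  finally show "h -` A \<inter> space (code_measure n) \<in> sets (code_measure n)" .
qed simp

context coding
begin

text \<open>Replacing all letters from \<open>m * k\<close> on by the empty set gives maps of
  finitely many letters, which converge pointwise to \<open>z\<close> by
  \<open>dist_le\<close>.\<close>

lemma measurable_z: "z \<in> borel_measurable (code_measure n)"
proof (rule borel_measurable_LIMSEQ_metric)
  define tr where "tr k w = (\<lambda>j. if j < m * k then w j else {})" for k and w :: "nat \<Rightarrow> nat set"
  have tr: "tr k w \<in> codes n" if "w \<in> codes n" for k w
    using that by (auto simp: tr_def codes_def)
  show "(\<lambda>w. z (tr k w)) \<in> borel_measurable (code_measure n)" for k
  proof (rule measurable_code_measure_finite_dependence[where K = "m * k"])
    fix w w' :: "nat \<Rightarrow> nat set" assume "\<And>j. j < m * k \<Longrightarrow> w j = w' j"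
    then have "tr k w = tr k w'" unfolding tr_def by (intro ext) simp
    then show "z (tr k w) = z (tr k w')" by simp
  qed
  fix w assume "w \<in> space (code_measure n)"
  then have w: "w \<in> codes n" by (simp add: space_code_measure)
  have "dist (z (tr k w)) (z w) \<le> 2 * \<delta> ^ (m * k) * D" for k
    by (intro dist_le tr w) (simp add: tr_def)
  then have "(\<lambda>k. dist (z (tr k w)) (z w)) \<longlonglongrightarrow> 0"
    by (intro tendsto_sandwich[OF _ _ tendsto_const scale_tendsto_0]) auto
  then show "(\<lambda>k. z (tr k w)) \<longlonglongrightarrow> z w" by (rule tendsto_dist_iff[THEN iffD2])
qed

text \<open>The factor \<open>2\<^sup>t (2\<^sup>n)\<^sup>m D\<^sup>t\<close> in the measure makes the lower regularity bound hold with
  constant 1.\<close>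

lemma regular_image:
  assumes n: "1 \<le> n" and t: "0 < t" and nt: "2 ^ n * \<delta> powr t = 1"
    and bdd: "bounded (z ` codes n)" and diam: "diameter (z ` codes n) \<le> D"
    and cpt: "\<And>C. C \<subseteq> z ` codes n \<Longrightarrow> closed C \<Longrightarrow> bounded C \<Longrightarrow> compact C"
  shows "regular_set_const t ((2 ^ n) ^ (2 * m)) (z ` codes n)"
proof -
  define F where "F = z ` codes n"
  define c where "c = 2 powr t * (2 ^ n) ^ m * D powr t"
  define \<mu> where "\<mu> = scale_measure (ennreal c) (distr (code_measure n) borel z)"
  have c: "0 \<le> c" by (simp add: c_def)
  have mass: "(1 / 2 ^ n) ^ i = (\<delta> ^ i) powr t" for i
  proof -
    have "1 / 2 ^ n = \<delta> powr t" using nt by (simp add: field_simps)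
    then show ?thesis by (induction i) (simp_all add: powr_mult \<delta>(1))
  qed
  \<comment> \<open>The factor \<open>(2 ^ n) ^ m\<close> in \<open>c\<close> shifts the scale by
    one block: a cylinder of \<open>Suc k\<close> blocks receives the \<open>t\<close>-th power of
    the scale of \<open>k\<close> blocks.\<close>
  have c_mass: "c * (1 / 2 ^ n) ^ (m * Suc k) = (2 * \<delta> ^ (m * k) * D) powr t" for k
  proof -
    have "c * (1 / 2 ^ n) ^ (m * Suc k) =
        2 powr t * D powr t * (1 / 2 ^ n) ^ (m * k) * ((2 ^ n) ^ m * (1 / 2 ^ n) ^ m)"
      unfolding c_def mult_Suc_right power_add by (simp only: mult_ac)
    also have "(2 ^ n) ^ m * (1 / 2 ^ n :: real) ^ m = 1"
      unfolding power_mult_distrib[symmetric] by simp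
    also have "2 powr t * D powr t * (1 / 2 ^ n) ^ (m * k) * 1 = (2 * \<delta> ^ (m * k) * D) powr t"
      unfolding mass powr_mult by (simp only: mult_ac mult_1_right)
    finally show ?thesis .
  qed
  have emeasure: "emeasure \<mu> A = ennreal c * emeasure (code_measure n) (z -` A \<inter> codes n)"
    if "A \<in> sets borel" for A
    using that by (simp add: \<mu>_def emeasure_distr[OF measurable_z] space_code_measure)
  have ball: "ennreal (r powr t) \<le> emeasure \<mu> (cball (z w) r) \<and>
      emeasure \<mu> (cball (z w) r) \<le> ennreal ((2 ^ n) ^ (2 * m) * r powr t)"
    if w: "w \<in> codes n" and r: "0 < r" "r \<le> D" for w r
  proof
    \<comment> \<open>The preimage of the ball lies between the cylinders of \<open>Suc k\<close>
      and of \<open>k\<close> blocks, by \<open>dist_le\<close> and \<open>dist_ge\<close>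
      respectively.\<close>
    from r obtain k where k: "2 * \<delta> ^ (m * Suc k) * D \<le> r" "r < 2 * \<delta> ^ (m * k) * D"
      by (rule scale_exists)
    define cyl where "cyl k = {w'\<in>codes n. \<forall>j<m * k. w' j = w j}" for k
    have cyl: "cyl k \<in> sets (code_measure n)"
      "emeasure (code_measure n) (cyl k) = ennreal ((1 / 2 ^ n) ^ (m * k))" for k
      using w by (auto simp: cyl_def cylinder_in_sets emeasure_cylinder)
    have zs: "z -` cball (z w) r \<inter> codes n \<in> sets (code_measure n)"
      using measurable_sets[OF measurable_z, of "cball (z w) r"] by (simp add: space_code_measure)
    have sub1: "cyl (Suc k) \<subseteq> z -` cball (z w) r \<inter> codes n"
    proof
      fix w' assume w': "w' \<in> cyl (Suc k)"
      then have "dist (z w) (z w') \<le> 2 * \<delta> ^ (m * Suc k) * D"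
        using w by (intro dist_le) (auto simp: cyl_def)
      then show "w' \<in> z -` cball (z w) r \<inter> codes n" using w' k(1) by (auto simp: cyl_def)
    qed
    have sub2: "z -` cball (z w) r \<inter> codes n \<subseteq> cyl k"
    proof
      fix w' assume w': "w' \<in> z -` cball (z w) r \<inter> codes n"
      have "w' j = w j" if j: "j < m * k" for j
      proof (rule ccontr)
        assume "w' j \<noteq> w j"
        \<comment> \<open>\<open>dist_ge\<close> needs a positive number of blocks; for
          \<open>k = 0\<close> there is no letter \<open>j\<close> to consider.\<close>
        obtain k' where "k = Suc k'" using j by (cases k) auto
        then have "2 * \<delta> ^ (m * k) * D \<le> dist (z w) (z w')"
          using dist_ge[of w w' j k'] w w' j \<open>w' j \<noteq> w j\<close> by auto
        moreover have "dist (z w) (z w') \<le> r" using w' by simp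
        ultimately show False using k(2) by linarith
      qed
      then show "w' \<in> cyl k" using w' by (auto simp: cyl_def)
    qed
    have "r powr t \<le> (2 * \<delta> ^ (m * k) * D) powr t"
      using r k t by (intro powr_mono2) auto
    also have "\<dots> = c * (1 / 2 ^ n) ^ (m * Suc k)" by (rule c_mass[symmetric])
    finally have "ennreal (r powr t) \<le> ennreal c * emeasure (code_measure n) (cyl (Suc k))"
      using c unfolding cyl(2) by (subst ennreal_mult[symmetric]) (auto intro!: ennreal_leI)
    also have "\<dots> \<le> ennreal c * emeasure (code_measure n) (z -` cball (z w) r \<inter> codes n)"
      by (intro mult_left_mono emeasure_mono sub1 zs) auto
    finally show "ennreal (r powr t) \<le> emeasure \<mu> (cball (z w) r)"
      by (simp add: emeasure)
    have "emeasure \<mu> (cball (z w) r) \<le> ennreal c * emeasure (code_measure n) (cyl k)"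
      by (simp add: emeasure) (intro mult_left_mono emeasure_mono sub2 cyl, auto)
    also have "\<dots> = ennreal (c * (1 / 2 ^ n) ^ (m * k))"
      using c unfolding cyl(2) by (subst ennreal_mult[symmetric]) auto
    \<comment> \<open>Two blocks are lost, one by the shift in \<open>c\<close> and one by enclosing
      \<open>r\<close> between consecutive scales. This produces the constant
      \<open>(2 ^ n) ^ (2 * m)\<close>.\<close>
    also have "c * (1 / 2 ^ n) ^ (m * k) =
        (2 ^ n) ^ (2 * m) * (c * (1 / 2 ^ n) ^ (m * Suc (Suc k)))"
    proof -
      have "(2 ^ n) ^ (2 * m) * (c * (1 / 2 ^ n) ^ (m * Suc (Suc k))) =
          ((2 ^ n) ^ (2 * m) * (1 / 2 ^ n) ^ (2 * m)) * (c * (1 / 2 ^ n) ^ (m * k))"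
      proof -
        have "m * Suc (Suc k) = 2 * m + m * k" by simp
        then show ?thesis by (simp only: power_add mult_ac)
      qed
      also have "(2 ^ n) ^ (2 * m) * (1 / 2 ^ n :: real) ^ (2 * m) = 1"
        unfolding power_mult_distrib[symmetric] by simp
      finally show ?thesis by (simp only: mult_1_left)
    qed
    also have "\<dots> = (2 ^ n) ^ (2 * m) * (2 * \<delta> ^ (m * Suc k) * D) powr t"
      by (simp only: c_mass)
    also have "ennreal \<dots> \<le> ennreal ((2 ^ n) ^ (2 * m) * r powr t)"
      using k(1) t \<delta> D by (intro ennreal_leI mult_left_mono powr_mono2) auto
    finally show "emeasure \<mu> (cball (z w) r) \<le> ennreal ((2 ^ n) ^ (2 * m) * r powr t)" .
  qed
  have two: "\<exists>x\<in>F. \<exists>y\<in>F. x \<noteq> y"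
  proof -
    \<comment> \<open>The letter \<open>{0}\<close> is admissible because
      \<open>1 \<le> n\<close>.\<close>
    define u v :: "nat \<Rightarrow> nat set" where "u = (\<lambda>_. {})" and "v = (\<lambda>_. {0})"
    have "u \<in> codes n" "v \<in> codes n" "u \<noteq> v"
      using n by (auto simp: u_def v_def codes_def fun_eq_iff)
    then have "z u \<in> F" "z v \<in> F" "z u \<noteq> z v"
      using z_eqD[of u v] by (auto simp: F_def)
    then show ?thesis by blast
  qed
  have null: "emeasure \<mu> (UNIV - F) = 0"
  proof -
    have "z -` (UNIV - F) \<inter> codes n = {}" by (auto simp: F_def)
    moreover have "UNIV - F \<in> sets borel"
      using closed_image unfolding F_def by (intro sets.Diff borel_closed) auto
    ultimately show ?thesis by (simp add: emeasure)
  qed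
  have sets: "sets \<mu> = sets borel" by (simp add: \<mu>_def)
  have "\<exists>\<mu> :: 'a measure. sets \<mu> = sets borel \<and> emeasure \<mu> (UNIV - F) = 0 \<and>
        (\<forall>x\<in>F. \<forall>r>0. (bounded F \<longrightarrow> r \<le> diameter F) \<longrightarrow>
           ennreal (r powr t) \<le> emeasure \<mu> (cball x r) \<and>
           emeasure \<mu> (cball x r) \<le> ennreal ((2 ^ n) ^ (2 * m) * r powr t))"
  proof (rule exI[of _ \<mu>], intro conjI[OF sets] conjI[OF null] ballI allI impI)
    fix x r assume "x \<in> F" and r: "0 < r" "bounded F \<longrightarrow> r \<le> diameter F"
    then obtain w where "w \<in> codes n" "x = z w" by (auto simp: F_def)
    moreover have "r \<le> D" using r(2) bdd diam by (simp add: F_def)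
    ultimately show "ennreal (r powr t) \<le> emeasure \<mu> (cball x r) \<and>
           emeasure \<mu> (cball x r) \<le> ennreal ((2 ^ n) ^ (2 * m) * r powr t)"
      using ball[OF _ r(1)] by blast
  qed
  moreover have "1 \<le> ((2::real) ^ n) ^ (2 * m)" by (intro one_le_power) simp
  ultimately show ?thesis
    unfolding regular_set_const_def F_def[symmetric]
    using t two closed_image[folded F_def] cpt[folded F_def] by blast
qed

end

subsection \<open>Codes of the points of the Cantor set\<close>

text \<open>Generation \<open>k\<close> is indexed by infinite words, of which only \<open>k\<close>
  letters count, so that all generations and the limit points share the index set
  \<open>codes n\<close>.\<close>

definition cantor_vertex :: "real \<Rightarrow> real \<Rightarrow> (nat \<Rightarrow> real) \<Rightarrow> nat \<Rightarrow> (nat \<Rightarrow> nat set) \<Rightarrow> nat \<Rightarrow> real" where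
  "cantor_vertex \<delta> a p k w i = p i + (\<Sum>j<k. of_bool (i \<in> w j) * (\<delta> ^ j * a - \<delta> ^ Suc j * a))"

text \<open>Coordinates from \<open>n\<close> on are 0, as \<open>closed_cube\<close> demands of its
  points; the vertices keep \<open>p i\<close> there, which \<open>closed_cube\<close>
  ignores.\<close>

definition cantor_point :: "nat \<Rightarrow> real \<Rightarrow> real \<Rightarrow> (nat \<Rightarrow> real) \<Rightarrow> (nat \<Rightarrow> nat set) \<Rightarrow> nat \<Rightarrow> real" where
  "cantor_point n \<delta> a p w i =
     (if i < n then p i + (\<Sum>j. of_bool (i \<in> w j) * (\<delta> ^ j * a - \<delta> ^ Suc j * a)) else 0)"

lemma cantor_vertex_cong:
  "(\<And>j. j < k \<Longrightarrow> w j = w' j) \<Longrightarrow> cantor_vertex \<delta> a p k w = cantor_vertex \<delta> a p k w'"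
  unfolding cantor_vertex_def by (intro ext arg_cong2[of _ _ _ _ "(+)"] sum.cong) auto

lemma cantor_vertex_Suc:
  "cantor_vertex \<delta> a p (Suc k) w i =
     cantor_vertex \<delta> a p k w i + of_bool (i \<in> w k) * (\<delta> ^ k * a - \<delta> ^ Suc k * a)"
  by (simp add: cantor_vertex_def)

lemma cantor_vertices_eq: "cantor_vertices n \<delta> a p k = cantor_vertex \<delta> a p k ` codes n"
proof (induction k)
  case 0
  have "(\<lambda>_. {}) \<in> codes n" by (simp add: codes_def)
  then have "codes n \<noteq> {}" by blast
  then show ?case by (auto simp: cantor_vertex_def fun_eq_iff)
next
  case (Suc k)
  have step: "(\<lambda>i. if i \<in> w k then cantor_vertex \<delta> a p k w i + \<delta> ^ k * a - \<delta> ^ Suc k * a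
      else cantor_vertex \<delta> a p k w i) = cantor_vertex \<delta> a p (Suc k) w" for w
    by (intro ext) (simp add: cantor_vertex_Suc)
  show ?case
  proof (intro equalityI subsetI)
    fix x assume "x \<in> cantor_vertices n \<delta> a p (Suc k)"
    then obtain w S where w: "w \<in> codes n" "S \<subseteq> {..<n}"
      and x: "x = (\<lambda>i. if i \<in> S then cantor_vertex \<delta> a p k w i + \<delta> ^ k * a - \<delta> ^ Suc k * a
        else cantor_vertex \<delta> a p k w i)"
      unfolding cantor_vertices.simps Suc by blast
    \<comment> \<open>Letter \<open>k\<close> has no influence on the vertex of generation
      \<open>k\<close>, so it can be overwritten by the new corner.\<close>
    define w' where "w' = w(k := S)"
    have "cantor_vertex \<delta> a p k w = cantor_vertex \<delta> a p k w'"
      by (rule cantor_vertex_cong) (simp add: w'_def)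
    moreover have "w' k = S" by (simp add: w'_def)
    ultimately have "x = cantor_vertex \<delta> a p (Suc k) w'"
      using step[of w'] by (simp only: x)
    moreover have "w' \<in> codes n" using w by (auto simp: w'_def codes_def)
    ultimately show "x \<in> cantor_vertex \<delta> a p (Suc k) ` codes n" by blast
  next
    fix x assume "x \<in> cantor_vertex \<delta> a p (Suc k) ` codes n"
    then obtain w where w: "w \<in> codes n" and x: "x = cantor_vertex \<delta> a p (Suc k) w" by blast
    have "w k \<subseteq> {..<n}" using w by (simp add: codes_def)
    with w show "x \<in> cantor_vertices n \<delta> a p (Suc k)"
      unfolding cantor_vertices.simps Suc x step[of w, symmetric] by blast
  qed
qed

text \<open>The offsets from generation \<open>k\<close> on are nonnegative and dominated by a
  telescoping series with sum \<open>\<delta> ^ k * a\<close>, the side of the cube.\<close>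

lemma cantor_point_in_cube:
  assumes \<delta>: "0 < \<delta>" "\<delta> < 1" and a: "0 < a"
  shows "cantor_point n \<delta> a p w \<in> closed_cube n (cantor_vertex \<delta> a p k w) (\<delta> ^ k * a)"
proof -
  have "cantor_vertex \<delta> a p k w i \<le> cantor_point n \<delta> a p w i \<and>
      cantor_point n \<delta> a p w i \<le> cantor_vertex \<delta> a p k w i + \<delta> ^ k * a" if i: "i < n" for i
  proof -
    define h where "h j = \<delta> ^ j * a - \<delta> ^ Suc j * a" for j
    define g where "g j = of_bool (i \<in> w j) * h j" for j
    have h: "0 \<le> h j" for j
      unfolding h_def using \<delta> a by (simp add: mult_le_cancel_right1)
    have g: "0 \<le> g j" "g j \<le> h j" for j using h[of j] by (auto simp: g_def)
    have hsums: "(\<lambda>j. h (j + k)) sums (\<delta> ^ k * a)" for k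
    proof -
      have "(\<lambda>j. \<delta> ^ j * (\<delta> ^ k * a)) \<longlonglongrightarrow> 0 * (\<delta> ^ k * a)"
        using \<delta> by (intro tendsto_mult LIMSEQ_realpow_zero tendsto_const) auto
      from telescope_sums'[OF this] show ?thesis
        by (simp add: h_def power_add mult_ac)
    qed
    have gsum: "summable (\<lambda>j. g (j + k))" for k
      by (rule summable_comparison_test'[OF sums_summable[OF hsums[of k]]]) (use g in auto)
    have "suminf g = (\<Sum>j. g (j + k)) + (\<Sum>j<k. g j)"
      using gsum[of 0] by (intro suminf_split_initial_segment) simp
    moreover have "0 \<le> (\<Sum>j. g (j + k))" using gsum g by (intro suminf_nonneg) auto
    moreover have "(\<Sum>j. g (j + k)) \<le> \<delta> ^ k * a"
      using suminf_le[OF _ gsum sums_summable[OF hsums[of k]]] g(2) sums_unique[OF hsums[of k]] by simp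
    ultimately show ?thesis
      using i by (simp add: cantor_point_def cantor_vertex_def g_def[abs_def] h_def)
  qed
  then show ?thesis by (simp add: closed_cube_def cantor_point_def)
qed

lemma closed_cube_cantor_vertex_mono:
  assumes \<delta>: "0 < \<delta>" "\<delta> < 1" and a: "0 < a" and "j \<le> k"
    and "x \<in> closed_cube n (cantor_vertex \<delta> a p k w) (\<delta> ^ k * a)"
  shows "x \<in> closed_cube n (cantor_vertex \<delta> a p j w) (\<delta> ^ j * a)"
  using assms(4,5)
proof (induction k rule: dec_induct)
  case (step k)
  have "0 \<le> \<delta> ^ k * a - \<delta> ^ Suc k * a" using \<delta> a by (simp add: mult_le_cancel_right1)
  then have "cantor_vertex \<delta> a p k w i \<le> cantor_vertex \<delta> a p (Suc k) w i \<and>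
      cantor_vertex \<delta> a p (Suc k) w i + \<delta> ^ Suc k * a \<le> cantor_vertex \<delta> a p k w i + \<delta> ^ k * a" for i
    unfolding cantor_vertex_Suc by (cases "i \<in> w k") auto
  then have "x \<in> closed_cube n (cantor_vertex \<delta> a p k w) (\<delta> ^ k * a)"
    using step.prems unfolding closed_cube_def by (auto intro: order_trans)
  then show ?case by (rule step.IH)
qed

text \<open>Both cubes lie in one parent of side \<open>\<delta> ^ j * a\<close> and touch its
  opposite faces in coordinate \<open>i\<close>, which leaves a gap of
  \<open>\<delta> ^ j * a - 2 * \<delta> ^ Suc j * a\<close>.\<close>

lemma closed_cube_cantor_vertex_sep:
  assumes "\<And>j'. j' < j \<Longrightarrow> w j' = w' j'" and i: "i \<in> w j" "i \<notin> w' j" "i < n"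
    and x: "x \<in> closed_cube n (cantor_vertex \<delta> a p (Suc j) w) (\<delta> ^ Suc j * a)"
    and x': "x' \<in> closed_cube n (cantor_vertex \<delta> a p (Suc j) w') (\<delta> ^ Suc j * a)"
  shows "(1 - 2 * \<delta>) * \<delta> ^ j * a \<le> x i - x' i"
proof -
  have "cantor_vertex \<delta> a p j w = cantor_vertex \<delta> a p j w'"
    by (rule cantor_vertex_cong) (rule assms)
  moreover have "cantor_vertex \<delta> a p (Suc j) w i \<le> x i"
    "x' i \<le> cantor_vertex \<delta> a p (Suc j) w' i + \<delta> ^ Suc j * a"
    using x x' i(3) by (simp_all add: closed_cube_def)
  then have "cantor_vertex \<delta> a p j w i + (\<delta> ^ j * a - \<delta> ^ Suc j * a) \<le> x i"
    "x' i \<le> cantor_vertex \<delta> a p j w' i + \<delta> ^ Suc j * a"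
    using i(1,2) by (simp_all add: cantor_vertex_Suc)
  ultimately show ?thesis by (simp add: algebra_simps)
qed

text \<open>At the first disagreement, some coordinate of the common point would differ from itself
  by at least the gap, which is positive for \<open>\<delta> < 1/2\<close>.\<close>

lemma closed_cube_cantor_vertex_agree:
  assumes \<delta>: "0 < \<delta>" "\<delta> < 1/2" and a: "0 < a" and w: "w \<in> codes n" "w' \<in> codes n"
    and x: "x \<in> closed_cube n (cantor_vertex \<delta> a p k w) (\<delta> ^ k * a)"
      "x \<in> closed_cube n (cantor_vertex \<delta> a p k w') (\<delta> ^ k * a)"
  shows "j < k \<Longrightarrow> w j = w' j"
proof (induction j rule: less_induct)
  case (less j)
  have eq: "w j' = w' j'" if "j' < j" for j' using less that by simp
  have \<delta>1: "\<delta> < 1" using \<delta> by simp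
  have cube: "x \<in> closed_cube n (cantor_vertex \<delta> a p (Suc j) w) (\<delta> ^ Suc j * a)"
    "x \<in> closed_cube n (cantor_vertex \<delta> a p (Suc j) w') (\<delta> ^ Suc j * a)"
    using closed_cube_cantor_vertex_mono[OF \<delta>(1) \<delta>1 a Suc_leI[OF less.prems]] x by blast+
  have pos: "0 < (1 - 2 * \<delta>) * \<delta> ^ j * a" using \<delta> a by simp
  have "i \<in> w' j" if i: "i \<in> w j" for i
  proof (rule ccontr)
    assume "i \<notin> w' j"
    moreover have "i < n" using w i by (auto simp: codes_def)
    ultimately have "(1 - 2 * \<delta>) * \<delta> ^ j * a \<le> x i - x i"
      using closed_cube_cantor_vertex_sep[of j w w' i n x \<delta> a p x, OF eq i _ _ cube] by blast
    with pos show False by simp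
  qed
  moreover have "i \<in> w j" if i: "i \<in> w' j" for i
  proof (rule ccontr)
    assume "i \<notin> w j"
    moreover have "i < n" using w i by (auto simp: codes_def)
    ultimately have "(1 - 2 * \<delta>) * \<delta> ^ j * a \<le> x i - x i"
      using closed_cube_cantor_vertex_sep[of j w' w i n x \<delta> a p x, OF eq[symmetric] i _ _ cube(2,1)] by blast
    with pos show False by simp
  qed
  ultimately show ?case by blast
qed

text \<open>Cubes of different words are disjoint, so the words of the cubes around a point are
  compatible and glue to a single code. The shrinking sides then identify the point.\<close>

lemma cantor_set_eq:
  assumes \<delta>: "0 < \<delta>" "\<delta> < 1/2" and a: "0 < a" and \<delta>_eq: "\<delta> = cantor_ratio n t"
  shows "cantor_set n t a p = cantor_point n \<delta> a p ` codes n"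
proof (intro equalityI subsetI)
  fix x assume "x \<in> cantor_set n t a p"
  \<comment> \<open>The intersection in \<open>cantor_set\<close> starts at generation 1, hence
    \<open>Suc k\<close>.\<close>
  then have "x \<in> (\<Union>q\<in>cantor_vertices n \<delta> a p (Suc k). closed_cube n q (\<delta> ^ Suc k * a))" for k
    unfolding cantor_set_def \<delta>_eq[symmetric] by (rule INT_D) simp
  then have "\<exists>w\<in>codes n. x \<in> closed_cube n (cantor_vertex \<delta> a p (Suc k) w) (\<delta> ^ Suc k * a)" for k
    unfolding cantor_vertices_eq by blast
  then obtain v where v: "\<And>k. v k \<in> codes n"
    "\<And>k. x \<in> closed_cube n (cantor_vertex \<delta> a p (Suc k) (v k)) (\<delta> ^ Suc k * a)" by metis
  define w where "w j = v j j" for j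
  have w: "w \<in> codes n" using v(1) by (auto simp: w_def codes_def)
  have agree: "v j j = v k j" if "j \<le> k" for j k
  proof (rule closed_cube_cantor_vertex_agree[OF \<delta> a v(1) v(1)])
    show "x \<in> closed_cube n (cantor_vertex \<delta> a p (Suc j) (v k)) (\<delta> ^ Suc j * a)"
      using \<delta> a that by (intro closed_cube_cantor_vertex_mono[OF _ _ _ _ v(2)[of k]]) auto
  qed (rule v lessI)+
  have xw: "x \<in> closed_cube n (cantor_vertex \<delta> a p (Suc k) w) (\<delta> ^ Suc k * a)" for k
  proof -
    have "cantor_vertex \<delta> a p (Suc k) w = cantor_vertex \<delta> a p (Suc k) (v k)"
      unfolding w_def by (rule cantor_vertex_cong, rule agree) simp
    then show ?thesis using v(2)[of k] by simp
  qed
  have "x i = cantor_point n \<delta> a p w i" for i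
  proof (cases "i < n")
    case True
    have "(\<lambda>k. \<delta> ^ Suc k * a) \<longlonglongrightarrow> 0 * a"
      using \<delta> by (intro tendsto_mult tendsto_const LIMSEQ_Suc[of "\<lambda>k. \<delta> ^ k"] LIMSEQ_realpow_zero) auto
    moreover have "\<bar>x i - cantor_point n \<delta> a p w i\<bar> \<le> \<delta> ^ Suc k * a" for k
    proof -
      have "cantor_point n \<delta> a p w \<in> closed_cube n (cantor_vertex \<delta> a p (Suc k) w) (\<delta> ^ Suc k * a)"
        using \<delta> a by (intro cantor_point_in_cube) auto
      then show ?thesis
        using xw[of k] True unfolding closed_cube_def mem_Collect_eq by (smt (verit))
    qed
    ultimately have "\<bar>x i - cantor_point n \<delta> a p w i\<bar> \<le> 0 * a"
      by (intro tendsto_lowerbound[of "\<lambda>k. \<delta> ^ Suc k * a" _ sequentially] always_eventually) auto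
    then show ?thesis by simp
  next
    case False
    then show ?thesis using xw[of 0] by (simp add: closed_cube_def cantor_point_def)
  qed
  then have "x = cantor_point n \<delta> a p w" by (rule ext)
  with w show "x \<in> cantor_point n \<delta> a p ` codes n" by blast
next
  fix x assume "x \<in> cantor_point n \<delta> a p ` codes n"
  then obtain w where w: "w \<in> codes n" "x = cantor_point n \<delta> a p w" by blast
  then have "x \<in> closed_cube n (cantor_vertex \<delta> a p k w) (\<delta> ^ k * a)" for k
    using \<delta> a cantor_point_in_cube[of \<delta> a n p w k] by simp
  then show "x \<in> cantor_set n t a p"
    unfolding cantor_set_def \<delta>_eq[symmetric] cantor_vertices_eq using w(1) by blast
qed

text \<open>If two words first differ at letter \<open>j\<close>, both distances are comparable to
  \<open>\<delta> ^ j * D\<close>. As \<open>z\<close> is controlled only at ends of blocks, the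
  constants lose a factor \<open>\<delta> ^ m\<close>.\<close>

lemma (in coding) bilipschitz_image:
  assumes \<delta>2: "\<delta> < 1 / 2" and \<delta>_eq: "\<delta> = cantor_ratio n t" and n: "1 \<le> n"
  shows "\<exists>f. bilipschitz_map dist (z ` codes n) (euclid_dist n) (cantor_set n t D p) f"
proof -
  define c where "c = cantor_point n \<delta> D p"
  define f where "f = c \<circ> inv_into (codes n) z"
  have f: "f (z w) = c w" if "w \<in> codes n" for w
    using that inj_on_z by (simp add: f_def)
  have image: "f ` z ` codes n = cantor_set n t D p"
    unfolding image_image cantor_set_eq[OF \<delta>(1) \<delta>2 D \<delta>_eq] using f by (auto simp: c_def)
  \<comment> \<open>\<open>real n\<close> comes from bounding the Euclidean norm by the sum of the
    coordinates, \<open>1 - 2 * \<delta>\<close> from the gap between neighbouring cubes, and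
    \<open>\<delta> ^ m\<close> from rounding \<open>j\<close> to blocks.\<close>
  define L1 where "L1 = real n / (2 * \<delta> ^ m)"
  define L2 where "L2 = 2 / ((1 - 2 * \<delta>) * \<delta> ^ m)"
  have \<delta>m: "0 < \<delta> ^ m" "0 < 1 - 2 * \<delta>" using \<delta> \<delta>2 by auto
  have L: "0 < L1" "0 < L2" using \<delta>m n by (auto simp: L1_def L2_def)
  have main: "euclid_dist n (c w) (c w') \<le> L1 * dist (z w) (z w') \<and>
      dist (z w) (z w') \<le> L2 * euclid_dist n (c w) (c w')"
    if w: "w \<in> codes n" "w' \<in> codes n" and ne: "w \<noteq> w'" for w w'
  proof -
    obtain j0 where "w j0 \<noteq> w' j0" using ne by blast
    define j where "j = (LEAST j. w j \<noteq> w' j)"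
    have j: "w j \<noteq> w' j" unfolding j_def by (rule LeastI) fact
    have below: "w i = w' i" if "i < j" for i using not_less_Least that unfolding j_def by blast
    define k where "k = j div m"
    have k1: "m * k \<le> j" by (simp add: k_def)
    have k2: "j < m * Suc k"
      using m by (simp add: k_def) (metis add.commute dividend_less_times_div mult_Suc_right)
    have \<delta>k: "\<delta> ^ j \<le> \<delta> ^ (m * k)" "\<delta> ^ (m * Suc k) \<le> \<delta> ^ j"
      using k1 k2 \<delta> by (auto intro!: power_decreasing simp del: mult_Suc_right)
    have up: "dist (z w) (z w') \<le> 2 * \<delta> ^ (m * k) * D"
      using k1 by (intro dist_le w below) simp
    have low: "2 * \<delta> ^ (m * Suc k) * D \<le> dist (z w) (z w')"
      using w j k2 by (rule dist_ge)
    have cube: "c v \<in> closed_cube n (cantor_vertex \<delta> D p i v) (\<delta> ^ i * D)" for v i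
      unfolding c_def using \<delta> D by (intro cantor_point_in_cube)
    \<comment> \<open>No letter before \<open>j\<close> differs, so both points lie in one cube of
      side \<open>\<delta> ^ j * D\<close>.\<close>
    have "cantor_vertex \<delta> D p j w = cantor_vertex \<delta> D p j w'" by (rule cantor_vertex_cong) (rule below)
    then have coord: "\<bar>c w i - c w' i\<bar> \<le> \<delta> ^ j * D" if "i < n" for i
      using cube[of w j] cube[of w' j] that unfolding closed_cube_def mem_Collect_eq by (smt (verit))
    have "euclid_dist n (c w) (c w') \<le> (\<Sum>i<n. \<bar>c w i - c w' i\<bar>)"
      unfolding euclid_dist_def by (rule L2_set_le_sum_abs)
    also have "\<dots> \<le> (\<Sum>i<n. \<delta> ^ j * D)" using coord by (intro sum_mono) simp
    also have "\<dots> = real n * (\<delta> ^ j * D)" by simp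
    also have "\<dots> \<le> real n * (\<delta> ^ (m * k) * D)"
      using \<delta>k(1) D by (intro mult_left_mono mult_right_mono) auto
    also have "\<dots> = L1 * (2 * \<delta> ^ (m * Suc k) * D)"
      using \<delta>m \<delta>(1) by (simp add: L1_def power_add)
    also have "\<dots> \<le> L1 * dist (z w) (z w')" using low L by (intro mult_left_mono) auto
    finally have 1: "euclid_dist n (c w) (c w') \<le> L1 * dist (z w) (z w')" .
    have "\<exists>i<n. (1 - 2 * \<delta>) * \<delta> ^ j * D \<le> \<bar>c w i - c w' i\<bar>"
    proof -
      have "\<exists>i. i \<in> w j \<and> i \<notin> w' j \<or> i \<in> w' j \<and> i \<notin> w j" using j by blast
      then obtain i where i: "i \<in> w j \<and> i \<notin> w' j \<or> i \<in> w' j \<and> i \<notin> w j" ..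
      then have "i < n" using w by (auto simp: codes_def)
      have "(1 - 2 * \<delta>) * \<delta> ^ j * D \<le> \<bar>c w i - c w' i\<bar>"
        using i
      proof
        assume "i \<in> w j \<and> i \<notin> w' j"
        then have "(1 - 2 * \<delta>) * \<delta> ^ j * D \<le> c w i - c w' i"
          using closed_cube_cantor_vertex_sep[of j w w' i n "c w" \<delta> D p "c w'", OF below _ _ \<open>i < n\<close> cube cube] by blast
        then show ?thesis by linarith
      next
        assume "i \<in> w' j \<and> i \<notin> w j"
        then have "(1 - 2 * \<delta>) * \<delta> ^ j * D \<le> c w' i - c w i"
          using closed_cube_cantor_vertex_sep[of j w' w i n "c w'" \<delta> D p "c w", OF below[symmetric] _ _ \<open>i < n\<close> cube cube] by blast
        then show ?thesis by linarith
      qed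
      then show ?thesis using \<open>i < n\<close> by blast
    qed
    then obtain i where i: "i < n" "(1 - 2 * \<delta>) * \<delta> ^ j * D \<le> \<bar>c w i - c w' i\<bar>" by blast
    have "\<bar>c w i - c w' i\<bar> \<le> L2_set (\<lambda>i. \<bar>c w i - c w' i\<bar>) {..<n}"
      using i(1) by (intro member_le_L2_set) auto
    also have "\<dots> = euclid_dist n (c w) (c w')"
      by (simp add: euclid_dist_def L2_set_def)
    finally have 2: "(1 - 2 * \<delta>) * \<delta> ^ j * D \<le> euclid_dist n (c w) (c w')" using i(2) by linarith
    have "2 * \<delta> ^ (m * k) * D = L2 * ((1 - 2 * \<delta>) * \<delta> ^ (m * Suc k) * D)"
      using \<delta>m \<delta>(1) by (simp add: L2_def power_add)
    also have "\<dots> \<le> L2 * ((1 - 2 * \<delta>) * \<delta> ^ j * D)"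
      using \<delta>k(2) \<delta>m D L by (intro mult_left_mono mult_right_mono) auto
    also have "\<dots> \<le> L2 * euclid_dist n (c w) (c w')" using 2 L by (intro mult_left_mono) auto
    finally have "dist (z w) (z w') \<le> L2 * euclid_dist n (c w) (c w')" using up by linarith
    with 1 show ?thesis ..
  qed
  define L where "L = max L1 L2"
  have Lpos: "0 < L" using L by (simp add: L_def)
  have "dist x y / L \<le> euclid_dist n (f x) (f y) \<and> euclid_dist n (f x) (f y) \<le> L * dist x y"
    if xy: "x \<in> z ` codes n" "y \<in> z ` codes n" for x y
  proof -
    from xy obtain w w' where w: "w \<in> codes n" "w' \<in> codes n" and xy': "x = z w" "y = z w'" by blast
    show ?thesis
    proof (cases "w = w'")
      case True
      then show ?thesis by (simp add: xy' euclid_dist_def L2_set_def)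
    next
      case False
      note M = main[OF w False]
      have nonneg: "0 \<le> euclid_dist n (c w) (c w')" by (simp add: euclid_dist_def)
      have "dist (z w) (z w') \<le> L * euclid_dist n (c w) (c w')"
        using M mult_right_mono[of L2 L, OF _ nonneg] by (simp add: L_def)
      moreover have "euclid_dist n (c w) (c w') \<le> L * dist (z w) (z w')"
        using M mult_right_mono[of L1 L "dist (z w) (z w')"] by (simp add: L_def)
      ultimately show ?thesis
        using Lpos w by (simp add: xy' f field_simps)
    qed
  qed
  then show ?thesis
    unfolding bilipschitz_map_def using image Lpos by blast
qed

subsection \<open>Uniformity of the constant\<close>

text \<open>Since \<open>2 ^ n * \<delta> powr s = \<delta> powr (s - t) < 1\<close>, the number of
  children grows more slowly than the volume count allows: the second expression is a constant times
  a null sequence in \<open>m\<close>.\<close>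

lemma block_length_exists:
  fixes \<delta> s t K :: real
  assumes \<delta>: "0 < \<delta>" "\<delta> < 1" and st: "t < s" and nt: "2 ^ n * \<delta> powr t = 1"
  shows "\<exists>m>0. 4 * \<delta> ^ m \<le> 1 \<and> (2 ^ n) ^ m * (K * (8 * \<delta> ^ m) powr s) \<le> 1"
proof -
  define \<theta> where "\<theta> = 2 ^ n * \<delta> powr s"
  have "\<theta> = (2 ^ n * \<delta> powr t) * \<delta> powr (s - t)"
    using \<delta> by (simp add: \<theta>_def powr_diff)
  then have "\<theta> = \<delta> powr (s - t)" using nt by simp
  moreover have "\<delta> powr (s - t) < 1" using \<delta> st by (simp add: powr_def mult_pos_neg)
  ultimately have \<theta>: "0 \<le> \<theta>" "\<theta> < 1" by auto
  have pow: "(\<delta> ^ m) powr s = (\<delta> powr s) ^ m" for m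
    by (induction m) (simp_all add: powr_mult \<delta>(1))
  have eq: "(2 ^ n) ^ m * (K * (8 * \<delta> ^ m) powr s) = K * 8 powr s * \<theta> ^ m" for m
    unfolding \<theta>_def power_mult_distrib powr_mult pow by (simp only: mult_ac)
  have "(\<lambda>m. K * 8 powr s * \<theta> ^ m) \<longlonglongrightarrow> K * 8 powr s * 0"
    using \<theta> by (intro tendsto_mult tendsto_const LIMSEQ_realpow_zero)
  then have "eventually (\<lambda>m. K * 8 powr s * \<theta> ^ m < 1) sequentially"
    by (rule order_tendstoD) simp
  moreover have "(\<lambda>m. 4 * \<delta> ^ m) \<longlonglongrightarrow> 4 * 0"
    using \<delta> by (intro tendsto_mult tendsto_const LIMSEQ_realpow_zero) auto
  then have "eventually (\<lambda>m. 4 * \<delta> ^ m < 1) sequentially" by (rule order_tendstoD) simp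
  moreover have "eventually (\<lambda>m::nat. 0 < m) sequentially" by (rule eventually_gt_at_top)
  ultimately have "eventually (\<lambda>m. 0 < m \<and> 4 * \<delta> ^ m \<le> 1 \<and>
      (2 ^ n) ^ m * (K * (8 * \<delta> ^ m) powr s) \<le> 1) sequentially"
    unfolding eq by eventually_elim simp
  from eventually_happens'[OF sequentially_bot this] show ?thesis .
qed

text \<open>\<open>m\<close> is found from \<open>s\<close>, \<open>t\<close>, \<open>n\<close> and
  \<open>K\<close> before \<open>E\<close> and \<open>p\<close> are fixed, so
  \<open>(2 ^ n) ^ (2 * m)\<close> serves them all.\<close>

lemma regular_subset_const_exists:
  assumes "0 < t" "t < s" "1 \<le> n" "t < real n"
  shows "\<exists>C. \<forall>(E :: 'a::metric_space set) p.
        regular_set_const s K E \<longrightarrow> bounded E \<longrightarrow>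
        (\<exists>F f C_F. F \<subseteq> E \<and> regular_set_const t C_F F \<and>
           bilipschitz_map dist F (euclid_dist n) (cantor_set n t (diameter E) p) f \<and> C_F \<le> C)"
proof -
  define \<delta> where "\<delta> = cantor_ratio n t"
  have ratio: "0 < \<delta>" "\<delta> < 1 / 2" "2 ^ n * \<delta> powr t = 1"
    using cantor_ratio_iff[OF assms(1,4), of \<delta>] by (auto simp: \<delta>_def)
  then have ratio1: "\<delta> < 1" by simp
  obtain m where block: "0 < m" "4 * \<delta> ^ m \<le> 1" "(2 ^ n) ^ m * (K * (8 * \<delta> ^ m) powr s) \<le> 1"
    using block_length_exists[OF ratio(1) ratio1 assms(2) ratio(3)] by blast
  show ?thesis
  proof (intro exI[of _ "(2 ^ n) ^ (2 * m)"] allI impI)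
    fix E :: "'a set" and p
    assume reg: "regular_set_const s K E" and bdd: "bounded E"
    obtain z where zE: "z ` codes n \<subseteq> E" and "coding z n m \<delta> (diameter E)"
      using coding_exists[OF reg bdd block(1) ratio(1) ratio1 block(2,3)] by blast
    then interpret coding z n m \<delta> "diameter E" by simp
    have "regular_set_const t ((2 ^ n) ^ (2 * m)) (z ` codes n)"
    proof (rule regular_image[OF assms(3,1) ratio(3)])
      show "bounded (z ` codes n)" using bdd zE by (rule bounded_subset)
      show "diameter (z ` codes n) \<le> diameter E" using zE bdd by (rule diameter_subset)
      fix C assume "C \<subseteq> z ` codes n" "closed C" "bounded C"
      then show "compact C" using reg zE unfolding regular_set_const_def by blast
    qed
    moreover obtain f where "bilipschitz_map dist (z ` codes n) (euclid_dist n)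
        (cantor_set n t (diameter E) p) f"
      using bilipschitz_image[OF ratio(2) \<delta>_def assms(3)] by blast
    ultimately show "\<exists>F f C_F. F \<subseteq> E \<and> regular_set_const t C_F F \<and>
           bilipschitz_map dist F (euclid_dist n) (cantor_set n t (diameter E) p) f \<and>
           C_F \<le> (2 ^ n) ^ (2 * m)"
      using zE by (intro exI conjI) (assumption | rule order_refl)+
  qed
qed

section \<open>Transport along isometric embeddings\<close>

lemma diameter_isometric_image:
  assumes "\<And>x y. x \<in> E \<Longrightarrow> y \<in> E \<Longrightarrow> dist (h x) (h y) = dist x y"
  shows "diameter (h ` E) = diameter E"
proof -
  have "h ` E \<times> h ` E = (\<lambda>(x, y). (h x, h y)) ` (E \<times> E)" by auto
  then have "(\<lambda>(x, y). dist x y) ` (h ` E \<times> h ` E) = (\<lambda>(x, y). dist x y) ` (E \<times> E)"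
    by (simp only: image_image, intro image_cong) (auto simp: assms)
  then show ?thesis by (simp add: diameter_def)
qed

text \<open>The image under \<open>h\<close> of the measure restricted to \<open>E\<close> works;
  off \<open>E\<close> nothing is known about \<open>h\<close>, not even measurability. The lemma
  carries \<open>E\<close> into the bounded sequences and the subset found there back.\<close>

lemma regular_set_const_isometric_image:
  fixes h :: "'a::metric_space \<Rightarrow> 'b::metric_space"
  assumes reg: "regular_set_const s K E" and bdd: "bounded E"
    and iso: "\<And>x y. x \<in> E \<Longrightarrow> y \<in> E \<Longrightarrow> dist (h x) (h y) = dist x y"
  shows "regular_set_const s K (h ` E)"
proof -
  from reg obtain \<mu> :: "'a measure" where
    K: "0 < s" "1 \<le> K" and E: "closed E" and two: "\<exists>x\<in>E. \<exists>y\<in>E. x \<noteq> y"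
    and sets: "sets \<mu> = sets borel" and null: "emeasure \<mu> (UNIV - E) = 0"
    and ball: "\<And>x r. x \<in> E \<Longrightarrow> 0 < r \<Longrightarrow> r \<le> diameter E \<Longrightarrow>
      ennreal (r powr s) \<le> emeasure \<mu> (cball x r) \<and> emeasure \<mu> (cball x r) \<le> ennreal (K * r powr s)"
    unfolding regular_set_const_def by blast
  have cont: "continuous_on E h"
    unfolding continuous_on_iff by (auto simp: iso)
  \<comment> \<open>Compactness makes the image closed in the new space and its closed subsets
    compact.\<close>
  have cpt: "compact (h ` E)"
    using cont regular_set_const_compact[OF reg bdd] by (rule compact_continuous_image)
  have Es: "E \<in> sets \<mu>" using E by (simp add: sets)
  define \<nu> where "\<nu> = distr (restrict_space \<mu> E) borel h"
  have meas: "h \<in> borel_measurable (restrict_space \<mu> E)"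
    using borel_measurable_continuous_on_restrict[OF cont]
    by (subst measurable_cong_sets[OF sets_restrict_space_cong[OF sets] refl])
  have space: "space \<mu> = UNIV" using sets_eq_imp_space_eq[OF sets] by simp
  have \<nu>: "emeasure \<nu> A = emeasure \<mu> (h -` A \<inter> E)" if "A \<in> sets borel" for A
    using that Es unfolding \<nu>_def
    by (simp add: emeasure_distr[OF meas] emeasure_restrict_space space_restrict_space space)
  \<comment> \<open>Within \<open>E\<close> the preimage of a ball is the ball itself, and what the
    ball has outside \<open>E\<close> is null.\<close>
  have "UNIV - E \<in> null_sets \<mu>" using null E by (auto simp: sets null_sets_def)
  then have \<nu>_ball: "emeasure \<nu> (cball (h x) r) = emeasure \<mu> (cball x r)" if "x \<in> E" for x r
  proof -
    assume N: "UNIV - E \<in> null_sets \<mu>"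
    have "h -` cball (h x) r \<inter> E = cball x r - (UNIV - E)" using that iso by auto
    then show ?thesis using emeasure_Diff_null_set[OF N] by (simp add: \<nu> sets)
  qed
  have two': "\<exists>x\<in>h ` E. \<exists>y\<in>h ` E. x \<noteq> y"
  proof -
    obtain x y where "x \<in> E" "y \<in> E" "x \<noteq> y" using two by blast
    moreover from this have "h x \<noteq> h y" using iso[of x y] by auto
    ultimately show ?thesis by blast
  qed
  have closed_cpt: "\<forall>C. C \<subseteq> h ` E \<longrightarrow> closed C \<longrightarrow> bounded C \<longrightarrow> compact C"
  proof (intro allI impI)
    fix C assume "C \<subseteq> h ` E" "closed C"
    then show "compact C" using compact_Int_closed[OF cpt, of C] by (simp add: Int_absorb1)
  qed
  have diam: "diameter (h ` E) = diameter E" using iso by (rule diameter_isometric_image)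
  have "\<exists>\<nu> :: 'b measure. sets \<nu> = sets borel \<and> emeasure \<nu> (UNIV - h ` E) = 0 \<and>
        (\<forall>x\<in>h ` E. \<forall>r>0. (bounded (h ` E) \<longrightarrow> r \<le> diameter (h ` E)) \<longrightarrow>
           ennreal (r powr s) \<le> emeasure \<nu> (cball x r) \<and>
           emeasure \<nu> (cball x r) \<le> ennreal (K * r powr s))"
  proof (rule exI[of _ \<nu>], intro conjI ballI allI impI)
    show "sets \<nu> = sets borel" by (simp add: \<nu>_def)
    have "h -` (UNIV - h ` E) \<inter> E = {}" by blast
    then show "emeasure \<nu> (UNIV - h ` E) = 0"
      using compact_imp_closed[OF cpt] by (subst \<nu>) auto
  next
    fix y r assume "y \<in> h ` E" and r: "0 < r" "bounded (h ` E) \<longrightarrow> r \<le> diameter (h ` E)"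
    then obtain x where x: "x \<in> E" "y = h x" by blast
    have "r \<le> diameter E" using r(2) compact_imp_bounded[OF cpt] diam by simp
    note * = ball[OF x(1) r(1) this]
    show "ennreal (r powr s) \<le> emeasure \<nu> (cball y r)"
      "emeasure \<nu> (cball y r) \<le> ennreal (K * r powr s)"
      using * by (simp_all add: x \<nu>_ball)
  qed
  then show ?thesis
    unfolding regular_set_const_def using K two' closed_cpt compact_imp_closed[OF cpt] by blast
qed

text \<open>Frechet's embedding: the coordinates are the distances from a dense sequence.\<close>

lemma compact_isometric_bcontfun:
  fixes E :: "'a::metric_space set"
  assumes cpt: "compact E" and ne: "E \<noteq> {}"
  shows "\<exists>h :: 'a \<Rightarrow> (nat \<Rightarrow>\<^sub>C real). \<forall>x\<in>E. \<forall>y\<in>E. dist (h x) (h y) = dist x y"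
proof -
  \<comment> \<open>Finite nets at all scales \<open>1 / real (Suc k)\<close> together form a
    countable dense subset of \<open>E\<close>.\<close>
  have "\<exists>N. finite N \<and> N \<subseteq> E \<and> E \<subseteq> (\<Union>x\<in>N. ball x (1 / real (Suc k)))" for k
    using seq_compact_imp_totally_bounded[OF compact_imp_seq_compact[OF cpt], rule_format, of "1 / real (Suc k)"]
    by simp
  then obtain N where N: "\<And>k. finite (N k)" "\<And>k. N k \<subseteq> E"
    "\<And>k. E \<subseteq> (\<Union>x\<in>N k. ball x (1 / real (Suc k)))" by metis
  define S where "S = (\<Union>k. N k)"
  have S: "countable S" "S \<subseteq> E"
    unfolding S_def using N(1,2) by (auto intro: countable_finite)
  moreover have "S \<noteq> {}"
    using ne N(3)[of 0] unfolding S_def by fastforce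
  ultimately have S: "countable S" "S \<subseteq> E" "S \<noteq> {}" by auto
  define e where "e = from_nat_into S"
  have eE: "e i \<in> E" for i using from_nat_into[OF S(3), of i] S(2) by (auto simp: e_def)
  have dense: "\<exists>i. dist x (e i) < \<epsilon>" if x: "x \<in> E" and "0 < \<epsilon>" for x \<epsilon>
  proof -
    obtain k where k: "1 / real (Suc k) < \<epsilon>"
      using reals_Archimedean[OF \<open>0 < \<epsilon>\<close>] by (auto simp: inverse_eq_divide)
    obtain y where y: "y \<in> N k" "dist y x < 1 / real (Suc k)" using N(3)[of k] x by auto
    then have "y \<in> S" by (auto simp: S_def)
    then obtain i where "e i = y" using from_nat_into_surj[OF S(1)] by (auto simp: e_def)
    then show ?thesis using y k by (intro exI[of _ i]) (simp add: dist_commute)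
  qed
  define h :: "'a \<Rightarrow> (nat \<Rightarrow>\<^sub>C real)" where "h x = Bcontfun (\<lambda>i. dist x (e i))" for x
  have h: "apply_bcontfun (h x) i = dist x (e i)" if "x \<in> E" for x i
  proof -
    \<comment> \<open>Continuity is automatic on the discrete space of indices, and the diameter of
      \<open>E\<close> is a bound.\<close>
    have "(\<lambda>i. dist x (e i)) \<in> bcontfun"
    proof (rule bcontfun_normI)
      show "continuous_on UNIV (\<lambda>i. dist x (e i))"
        by simp
      show "norm (dist x (e i)) \<le> diameter E" for i
        using diameter_bounded_bound[OF compact_imp_bounded[OF cpt] that eE] by simp
    qed
    then show ?thesis by (simp add: h_def Bcontfun_inverse)
  qed
  have "dist (h x) (h y) = dist x y" if xy: "x \<in> E" "y \<in> E" for x y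
  proof (rule antisym)
    show "dist (h x) (h y) \<le> dist x y"
    proof (rule dist_bound)
      fix i
      show "dist (apply_bcontfun (h x) i) (apply_bcontfun (h y) i) \<le> dist x y"
        using dist_triangle[of x "e i" y] dist_triangle3[of y "e i" x]
        by (simp add: h xy dist_real_def dist_commute)
    qed
    show "dist x y \<le> dist (h x) (h y)"
    proof (rule field_le_epsilon)
      fix \<epsilon> :: real assume "0 < \<epsilon>"
      \<comment> \<open>At an \<open>e i\<close> close to \<open>x\<close>, the coordinates differ
        by at least \<open>dist x y - 2 * dist x (e i)\<close>.\<close>
      then obtain i where i: "dist x (e i) < \<epsilon> / 2" using dense[OF xy(1), of "\<epsilon> / 2"] by auto
      have "dist (apply_bcontfun (h x) i) (apply_bcontfun (h y) i) \<le> dist (h x) (h y)"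
        by (rule dist_bounded)
      then show "dist x y \<le> dist (h x) (h y) + \<epsilon>"
        using i dist_triangle2[of x y "e i"] by (simp add: h xy dist_real_def)
    qed
  qed
  then show ?thesis by blast
qed

theorem theorem3p1:
  fixes E :: "'a::metric_space set" and s t C_E :: real and n :: nat and p :: "nat \<Rightarrow> real"
  assumes "regular_set_const s C_E E"
    and "bounded E"
    and "0 < t" "t < s"
    and "1 \<le> n" "t < real n"
  shows "\<exists>F f C_F. F \<subseteq> E \<and> regular_set_const t C_F F \<and>
           bilipschitz_map dist F (euclid_dist n) (cantor_set n t (diameter E) p) f \<and>
           C_F \<le> regular_subset_const s t n C_E"
proof -
  have "compact E" using assms(1,2) by (rule regular_set_const_compact)
  moreover have "E \<noteq> {}" using assms(1) unfolding regular_set_const_def by blast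
  ultimately obtain h :: "'a \<Rightarrow> (nat \<Rightarrow>\<^sub>C real)"
    where h: "\<And>x y. x \<in> E \<Longrightarrow> y \<in> E \<Longrightarrow> dist (h x) (h y) = dist x y"
    using compact_isometric_bcontfun by metis
  have "bounded (h ` E)"
    unfolding bounded_two_points using diameter_bounded_bound[OF assms(2)] h
    by (intro exI[of _ "diameter E"]) auto
  moreover have "regular_set_const s C_E (h ` E)"
    using assms(1,2) h by (rule regular_set_const_isometric_image)
  \<comment> \<open>The instance for bounded sequences provides an admissible constant, so the value
    selected by \<open>SOME\<close> is admissible too.\<close>
  moreover have "\<forall>(E :: (nat \<Rightarrow>\<^sub>C real) set) p.
      regular_set_const s C_E E \<longrightarrow> bounded E \<longrightarrow>
      (\<exists>F f C_F. F \<subseteq> E \<and> regular_set_const t C_F F \<and>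
         bilipschitz_map dist F (euclid_dist n) (cantor_set n t (diameter E) p) f \<and>
         C_F \<le> regular_subset_const s t n C_E)"
    unfolding regular_subset_const_def by (rule someI_ex[OF regular_subset_const_exists[OF assms(3-6)]])
  ultimately have "\<exists>F f C_F. F \<subseteq> h ` E \<and> regular_set_const t C_F F \<and>
         bilipschitz_map dist F (euclid_dist n) (cantor_set n t (diameter (h ` E)) p) f \<and>
         C_F \<le> regular_subset_const s t n C_E" by simp
  then obtain F' f' C_F where F': "F' \<subseteq> h ` E" "regular_set_const t C_F F'"
    and f': "bilipschitz_map dist F' (euclid_dist n) (cantor_set n t (diameter (h ` E)) p) f'"
    and C_F: "C_F \<le> regular_subset_const s t n C_E"
    by blast
  \<comment> \<open>The subset returns to \<open>E\<close> along the inverse isometry; precomposing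
    \<open>f'\<close> with \<open>h\<close> keeps its bilipschitz constant.\<close>
  define g where "g = inv_into E h"
  have gE: "g y \<in> E" and hg: "h (g y) = y" if "y \<in> h ` E" for y
    using that by (auto simp: g_def inv_into_into f_inv_into_f)
  have iso: "dist (g x) (g y) = dist x y" if "x \<in> F'" "y \<in> F'" for x y
    using h[OF gE gE, of x y] hg subsetD[OF F'(1)] that by simp
  have "bounded F'" using \<open>bounded (h ` E)\<close> F'(1) by (rule bounded_subset)
  show ?thesis
  proof (intro exI conjI)
    show "g ` F' \<subseteq> E" using F'(1) gE by blast
    show "regular_set_const t C_F (g ` F')"
      using F'(2) \<open>bounded F'\<close> iso by (rule regular_set_const_isometric_image)
    have hgF: "h (g y) = y" if "y \<in> F'" for y using that F'(1) hg by blast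
    then have "(f' \<circ> h) ` g ` F' = f' ` F'"
      by (simp add: image_image)
    moreover have "diameter (h ` E) = diameter E" using h by (rule diameter_isometric_image)
    ultimately show "bilipschitz_map dist (g ` F') (euclid_dist n) (cantor_set n t (diameter E) p) (f' \<circ> h)"
      using f' hgF iso unfolding bilipschitz_map_def by simp
    show "C_F \<le> regular_subset_const s t n C_E" by fact
  qed
qed

end
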